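(* For $n\ge 0$ let \[ a_n:=\sum_{k=0}^n\binom{n}{k}^2\binom{2k}{n}^2 . \] Then the ordinary power series generating function $A(x)=\sum_{n\ge 0}a_nx^n$ of $\{a_n\}_{n\ge 0}$ has a square root with integer coefficients; that is, there exists a formal power series $B(x)=\sum_{n\ge 0}b_nx^n$ with all $b_n\in\mathbb{Z}$ such that $B(x)^2=A(x)$.
   Context: For non-negative integers $a,b$, $\binom{a}{b}=0$ if $b>a$. *)

theory Defs
  imports "HOL-Computational_Algebra.Formal_Power_Series"
begin

definition a_seq :: "nat \<Rightarrow> int" where
  "a_seq n = (\<Sum>k=0..n. int (n choose k) ^ 2 * int ((2 * k) choose n) ^ 2)"

definition A_gf :: "int fps" where
  "A_gf = Abs_fps a_seq"

end

theory Submission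
  imports Defs
begin

unbundle fps_syntax

text \<open>
  Put \<open>A = A_gf\<close>. Since \<open>(n choose k) * (2k choose n) = (2k choose k) * (k choose (n - k))\<close>, and the
  central binomial coefficient \<open>2k choose k\<close> is even for \<open>k > 0\<close>, every term of \<open>a_seq n\<close> with
  \<open>k > 0\<close> is divisible by 4; the term \<open>k = 0\<close> vanishes for \<open>n > 0\<close>. Hence \<open>A = 1 + 4 F\<close> with \<open>F\<close>
  integral and \<open>F(0) = 0\<close>. As \<open>(1 + 2 G)\<^sup>2 = 1 + 4 (G + G\<^sup>2)\<close>, it suffices to solve
  \<open>G + G\<^sup>2 = F\<close>, and this equation determines the coefficients of a solution \<open>G\<close> with \<open>G(0) = 0\<close>
  recursively, without any division.
\<close>

text \<open>
  Coefficients of the power series \<open>H\<close> with \<open>H + X H\<^sup>2 = \<Sum>n. f n X\<^sup>n\<close>.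
\<close>
fun quadratic_coeff :: "(nat \<Rightarrow> 'a::comm_ring_1) \<Rightarrow> nat \<Rightarrow> 'a" where
  "quadratic_coeff f 0 = f 0"
| "quadratic_coeff f (Suc n) =
     f (Suc n) - (\<Sum>i=0..n. quadratic_coeff f i * quadratic_coeff f (n - i))"

lemma fps_quadratic_solvable:
  fixes F :: "'a::comm_ring_1 fps"
  assumes "F $ 0 = 0"
  shows "\<exists>G. G + G ^ 2 = F"
proof -
  define H where "H = Abs_fps (quadratic_coeff (\<lambda>n. F $ Suc n))"
  have H_nth: "H $ n = quadratic_coeff (\<lambda>n. F $ Suc n) n" for n
    by (simp add: H_def)
  have "H + fps_X * H ^ 2 = fps_shift 1 F"
  proof (rule fps_ext)
    fix n
    show "(H + fps_X * H ^ 2) $ n = fps_shift 1 F $ n"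
      by (cases n) (simp_all add: H_nth power2_eq_square fps_mult_nth[of H H])
  qed
  then have "fps_X * H + (fps_X * H) ^ 2 = fps_X * fps_shift 1 F"
    by (metis distrib_left mult.assoc mult.left_commute power2_eq_square)
  also have "\<dots> = F"
  proof (rule fps_ext)
    fix n
    show "(fps_X * fps_shift 1 F) $ n = F $ n"
      using assms by (cases n) simp_all
  qed
  finally show ?thesis by blast
qed

lemma fps_sqrt_one_plus_four_times:
  fixes F :: "'a::comm_ring_1 fps"
  assumes "F $ 0 = 0"
  shows "\<exists>B. B ^ 2 = 1 + 4 * F"
proof -
  obtain G where "G + G ^ 2 = F"
    using fps_quadratic_solvable[OF assms] by blast
  then have "(1 + 2 * G) ^ 2 = 1 + 4 * F"
    by (auto simp: power2_eq_square algebra_simps)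
  then show ?thesis by blast
qed

lemma even_central_binomial:
  assumes "k > 0"
  shows "even ((2 * k) choose k)"
proof -
  obtain m where m: "k = Suc m"
    using assms by (cases k) auto
  have "Suc (2 * m) choose Suc m = Suc (2 * m) choose m"
    by (subst binomial_symmetric) auto
  then show ?thesis by (simp add: m)
qed

lemma even_choose_mult_choose:
  assumes "n > 0"
  shows "even ((n choose k) * ((2 * k) choose n))"
proof (cases "0 < k \<and> k \<le> n \<and> n \<le> 2 * k")
  case True
  then have "(n choose k) * ((2 * k) choose n) = ((2 * k) choose k) * (k choose (n - k))"
    using choose_mult[of k n "2 * k"] by (simp add: mult.commute)
  then show ?thesis
    using even_central_binomial True by simp
next
  case False
  then show ?thesis
    using assms by (auto simp: not_le binomial_eq_0)
qed

lemma four_dvd_a_seq: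
  assumes "n > 0"
  shows "4 dvd a_seq n"
  unfolding a_seq_def
proof (rule dvd_sum)
  fix k
  have "2 dvd int ((n choose k) * ((2 * k) choose n))"
    using even_choose_mult_choose[OF assms, of k] by simp
  then have "2 ^ 2 dvd int ((n choose k) * ((2 * k) choose n)) ^ 2"
    by (rule dvd_power_same)
  then show "4 dvd int (n choose k) ^ 2 * int ((2 * k) choose n) ^ 2"
    by (simp add: power_mult_distrib)
qed

theorem theorem6p2:
  shows "\<exists>B :: int fps. B ^ 2 = A_gf"
proof -
  \<comment> \<open>\<open>a_seq 0 = 1\<close>, so the integer division also gives the required constant term 0.\<close>
  define F where "F = Abs_fps (\<lambda>n. a_seq n div 4)"
  have a0: "a_seq 0 = 1"
    by (simp add: a_seq_def)
  have "A_gf = 1 + 4 * F"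
  proof (rule fps_ext)
    fix n
    show "A_gf $ n = (1 + 4 * F) $ n"
      using four_dvd_a_seq[of n] a0
      by (cases "n = 0") (auto simp: A_gf_def F_def numeral_fps_const)
  qed
  moreover have "F $ 0 = 0"
    by (simp add: F_def a0)
  ultimately show ?thesis
    using fps_sqrt_one_plus_four_times by metis
qed

end
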